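(* Let $\mathcal L^1$ be a two-level system with $K$ regional distribution centres, centre weights $\mathbf p^1=(p^1_1,\ldots,p^1_K)$, and, for each centre $\ell=1,\ldots,K$, a number $H_\ell$ of retailers with weights $\mathbf q^{1,\ell}=(q^{1,\ell}_1,\ldots,q^{1,\ell}_{H_\ell})$. Let $\mathcal L^2$ be a two-level system with $M$ regional distribution centres, $M<K$, centre weights $\mathbf p^2=(p^2_1,\ldots,p^2_M)$, and, for each centre $m=1,\ldots,M$, a number $G_m$ of retailers with weights $\mathbf q^{2,m}=(q^{2,m}_1,\ldots,q^{2,m}_{G_m})$. Write $\mathbf g^1=\oplus_{\ell=1}^K\left(p^1_\ell\,\mathbf q^{1,\ell}\right)$ and $\mathbf g^2=\oplus_{m=1}^M\left(p^2_m\,\mathbf q^{2,m}\right)$, where $\oplus$ denotes concatenation of vectors. If $\sum_{\ell=1}^K H_\ell=\sum_{m=1}^M G_m$ and $\mathbf g^1=\mathbf g^2$ (that is, the contribution of each retailer to the total demand is the same in both systems), then the pars-complexity values of the two systems coincide: $C_p(\mathcal L^1)=C_p(\mathcal L^2)$, i.e. $C_p(\mathbf g^1)=C_p(\mathbf g^2)$.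
   Context: For a vector $\mathbf w=(w_1,\ldots,w_n)$ of positive weights with $\sum_{i=1}^n w_i=1$, the pars-complexity is $C_p(\mathbf w)=\sum_{i=1}^n w_i\log_2\frac{1}{w_i}$. A two-level system $\mathcal L$ consists of $K$ regional distribution centres. Centre $\ell$ contributes a proportion $p_\ell>0$ of total sales, with $\sum_{\ell=1}^K p_\ell=1$. Centre $\ell$ has $H_\ell\ge 1$ retailers, and retailer $h$ of centre $\ell$ contributes a proportion $q^\ell_h>0$ of that centre's sales, with $\sum_{h=1}^{H_\ell}q^\ell_h=1$. Write $\mathbf q^\ell=(q^\ell_1,\ldots,q^\ell_{H_\ell})$. The contribution of retailer $h$ of centre $\ell$ to the total demand is $p_\ell q^\ell_h$. The pars-complexity of the system is $$C_p(\mathcal L)=\sum_{\ell=1}^K p_\ell\log_2\frac{1}{p_\ell}+\sum_{\ell=1}^K p_\ell\,C_p(\mathbf q^\ell),$$ which is the decomposed expression for the pars-complexity $C_p(\mathbf g)$ of the vector $\mathbf g=\oplus_{\ell=1}^K(p_\ell\,\mathbf q^\ell)$ of all retailers' contributions to the total demand. Here $\oplus_{i=1}^n\mathbf v_i=\mathbf v_1||\mathbf v_2||\cdots||\mathbf v_n$ denotes the concatenation of the vectors $\mathbf v_1,\ldots,\mathbf v_n$ in this order, and $p_\ell\,\mathbf q^\ell$ is the scalar multiple of the vector $\mathbf q^\ell$ by $p_\ell$. *)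

theory Defs
  imports Complex_Main
begin

definition weight_vector :: "real list \<Rightarrow> bool" where
  "weight_vector w \<longleftrightarrow> (\<forall>i<length w. 0 < w ! i) \<and> (\<Sum>i<length w. w ! i) = 1"

definition pars_complexity :: "real list \<Rightarrow> real" where
  "pars_complexity w = (\<Sum>i<length w. w ! i * log 2 (1 / w ! i))"

text \<open>
  Centres and retailers are numbered from 0: centre \<open>l\<close> has weight \<open>centre_weights L ! l\<close>,
  and the weights of its retailers, as proportions of that centre's own sales, form the
  vector \<open>retailer_weights L ! l\<close>.
\<close>

record two_level_system =
  centre_weights :: "real list"
  retailer_weights :: "real list list"

definition num_centres :: "two_level_system \<Rightarrow> nat" where
  "num_centres L = length (centre_weights L)"

definition num_retailers :: "two_level_system \<Rightarrow> nat \<Rightarrow> nat" where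
  "num_retailers L l = length (retailer_weights L ! l)"

definition valid_system :: "two_level_system \<Rightarrow> bool" where
  "valid_system L \<longleftrightarrow>
     weight_vector (centre_weights L) \<and>
     length (retailer_weights L) = num_centres L \<and>
     (\<forall>l<num_centres L. 1 \<le> num_retailers L l \<and> weight_vector (retailer_weights L ! l))"

definition scale_vector :: "real \<Rightarrow> real list \<Rightarrow> real list" where
  "scale_vector c v = map (\<lambda>x. c * x) v"

definition contributions :: "two_level_system \<Rightarrow> real list" where
  "contributions L =
     concat (map (\<lambda>l. scale_vector (centre_weights L ! l) (retailer_weights L ! l))
       [0..<num_centres L])"

definition system_pars_complexity :: "two_level_system \<Rightarrow> real" where
  "system_pars_complexity L =
     (\<Sum>l<num_centres L. centre_weights L ! l * log 2 (1 / centre_weights L ! l)) +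
     (\<Sum>l<num_centres L. centre_weights L ! l * pars_complexity (retailer_weights L ! l))"

end

theory Submission imports Defs begin

text \<open>
  The pars-complexity of a two-level system is the Shannon entropy of its vector of contributions,
  written out by the chain rule for entropy: first the uncertainty about the centre, then the
  average uncertainty about the retailer given the centre. The chain rule holds because the
  logarithm turns each product \<open>p\<^sub>l q\<^sub>h\<close> into a sum, and the weights \<open>q\<^sub>h\<close> within a centre
  sum to one. This is lemma \<open>system_pars_complexity_eq_contributions\<close>. So the pars-complexity
  depends on the system only through its contributions, whatever the grouping into centres, and
  systems with equal contributions have equal pars-complexity.
\<close>

text \<open>The form without indices, in which the complexity of a concatenation splits into a sum.\<close>

lemma pars_complexity_eq_sum_list:
  "pars_complexity w = (\<Sum>x\<leftarrow>w. x * log 2 (1 / x))"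
  by (simp add: pars_complexity_def sum_list_sum_nth atLeast0LessThan)

lemma pars_complexity_concat:
  "pars_complexity (concat vs) = (\<Sum>v\<leftarrow>vs. pars_complexity v)"
  by (induction vs) (simp_all add: pars_complexity_eq_sum_list)

text \<open>
  The contribution of a single centre to the chain rule. In
  \<open>c x log (1 / (c x)) = x (c log (1 / c)) + c (x log (1 / x))\<close>, summing over the entries \<open>x\<close>
  of \<open>v\<close> replaces the factor \<open>x\<close> of the first term by the total weight, which is one.
\<close>

lemma pars_complexity_scale_vector:
  assumes "0 < c" and "weight_vector v"
  shows "pars_complexity (scale_vector c v) = c * log 2 (1 / c) + c * pars_complexity v"
proof -
  have total: "(\<Sum>i<length v. v ! i) = 1"
    using assms(2) by (simp add: weight_vector_def)
  have "pars_complexity (scale_vector c v) =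
      (\<Sum>i<length v. (c * v ! i) * log 2 (1 / (c * v ! i)))"
    by (simp add: pars_complexity_def scale_vector_def)
  also have "\<dots> = (\<Sum>i<length v. v ! i * (c * log 2 (1 / c)) + c * (v ! i * log 2 (1 / v ! i)))"
  proof (rule sum.cong)
    fix i assume "i \<in> {..<length v}"
    then have "0 < v ! i"
      using assms(2) by (simp add: weight_vector_def)
    then show "(c * v ! i) * log 2 (1 / (c * v ! i)) =
        v ! i * (c * log 2 (1 / c)) + c * (v ! i * log 2 (1 / v ! i))"
      using assms(1) by (simp add: log_divide log_mult algebra_simps)
  qed simp
  also have "\<dots> = (\<Sum>i<length v. v ! i) * (c * log 2 (1 / c)) + c * pars_complexity v"
    by (simp add: sum.distrib pars_complexity_def flip: sum_distrib_left sum_distrib_right)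
  finally show ?thesis
    by (simp add: total)
qed

text \<open>The chain rule for entropy, one centre at a time.\<close>

lemma system_pars_complexity_eq_contributions:
  assumes "valid_system L"
  shows "system_pars_complexity L = pars_complexity (contributions L)"
proof -
  let ?p = "\<lambda>l. centre_weights L ! l" and ?q = "\<lambda>l. retailer_weights L ! l"
  have "pars_complexity (contributions L) =
      (\<Sum>l<num_centres L. pars_complexity (scale_vector (?p l) (?q l)))"
    by (simp add: contributions_def pars_complexity_concat comp_def interv_sum_list_conv_sum_set_nat
        atLeast0LessThan)
  also have "\<dots> = (\<Sum>l<num_centres L. ?p l * log 2 (1 / ?p l) + ?p l * pars_complexity (?q l))"
  proof (rule sum.cong)
    fix l assume "l \<in> {..<num_centres L}"
    then have "0 < ?p l" and "weight_vector (?q l)"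
      using assms by (simp_all add: valid_system_def weight_vector_def num_centres_def)
    then show "pars_complexity (scale_vector (?p l) (?q l)) =
        ?p l * log 2 (1 / ?p l) + ?p l * pars_complexity (?q l)"
      by (rule pars_complexity_scale_vector)
  qed simp
  finally show ?thesis
    by (simp add: system_pars_complexity_def sum.distrib)
qed

theorem proposition1:
  fixes L1 L2 :: two_level_system
  assumes "valid_system L1" and "valid_system L2"
    and "num_centres L2 < num_centres L1"
    and "(\<Sum>l<num_centres L1. num_retailers L1 l) = (\<Sum>m<num_centres L2. num_retailers L2 m)"
    and "contributions L1 = contributions L2"
  shows "system_pars_complexity L1 = system_pars_complexity L2 \<and>
         pars_complexity (contributions L1) = pars_complexity (contributions L2)"
  using assms(1,2,5) by (simp add: system_pars_complexity_eq_contributions)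

end
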